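(* Suppose that the data $(\{\xi^i\}_{i\ge1},h)$ satisfy: (i) $\xi^i\in L^2(\mathcal{F}^i_T)$ for each $i\ge 1$, and the $\xi^i$'s are independent copies of a random variable $\xi\in L^2(\mathcal{F}_T)$, with $\xi^1=\xi$; (ii) $h:\mathbb{R}\times\mathbb{R}\to\mathbb{R}$ satisfies $|h(y_1,z_1)-h(y_2,z_2)|\le \gamma_1|y_1-y_2|+\gamma_2|z_1-z_2|$ for all $y_1,y_2,z_1,z_2\in\mathbb{R}$, with positive constants $\gamma_1,\gamma_2$. Assume that $\gamma_1^2+\gamma_2^2<\frac1{16}$. For $i\ge1$, let $Y^i$ be the mean-field value-process defined in the context and set $$\hat\tau^i:=\inf\{t\ge0:\ Y^i_t=h(Y^i_t,\mathbb{E}[Y^i_t])\}\wedge T.$$ Then for every $i\ge1$ the stopping time $\hat\tau^i$ is optimal, i.e. $$\hat\tau^i\in\operatorname*{arg\,max}_{\tau\in\mathcal{T}^i_0}\ \mathbb{E}\big[h(Y^i_\tau,\mathbb{E}[Y^i_\tau])\mathbf{1}_{\{\tau<T\}}+\xi^i\mathbf{1}_{\{\tau=T\}}\big].$$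
   Context: $(\Omega,\mathcal{F},\mathbb{P})$ is a complete probability space, $T>0$ is a finite horizon, $\{W^i\}_{i\ge1}$ are independent standard one-dimensional Brownian motions on it, $W:=W^1$. $\mathbb{F}^i=\{\mathcal{F}^i_t\}_{t\in[0,T]}$ is the $\mathbb{P}$-completed filtration generated by $W^i$, $\mathbb{F}=\{\mathcal{F}_t\}:=\mathbb{F}^1$; $\mathcal{T}^i_t$ is the set of $\mathbb{F}^i$-stopping times with values in $[t,T]$ a.s. $L^2(\mathcal{G})$ is the set of square-integrable $\mathcal{G}$-measurable random variables. $\mathcal{S}^2_c$ (relative to the filtration considered) is the space of continuous real-valued progressively measurable processes $y$ with $\mathbb{E}[\sup_{u\in[0,T]}|y_u|^2]<\infty$. For each $i\ge1$, $Y^i$ is the unique solution in $\mathcal{S}^2_c$ (adapted to $\mathbb{F}^i$) of $$Y^i_t=\operatorname*{ess\,sup}_{\tau\in\mathcal{T}^i_t}\mathbb{E}\big[h(Y^i_\tau,\mathbb{E}[Y^i_\tau])\mathbf{1}_{\{\tau<T\}}+\xi^i\mathbf{1}_{\{\tau=T\}}\,\big|\,\mathcal{F}^i_t\big],\quad t\in[0,T].$$ Here $\mathbb{E}[Y^i_\tau]$ is the expectation of the random variable $Y^i_\tau$ (not the function $s\mapsto\mathbb{E}[Y^i_s]$ evaluated at $s=\tau$). Existence and uniqueness of the solution in $\mathcal{S}_c^2$ is known from the paper when $\gamma_1^2+\gamma_2^2<\tfrac12$. *)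

theory Defs
  imports "HOL-Probability.Probability"
begin

section \<open>Brownian motion and its completed filtration\<close>

definition standard_brownian_motion ::
  "'a measure \<Rightarrow> real \<Rightarrow> (real \<Rightarrow> 'a \<Rightarrow> real) \<Rightarrow> bool" where
  "standard_brownian_motion M T W \<longleftrightarrow>
     (\<forall>t\<in>{0..T}. W t \<in> borel_measurable M) \<and>
     (AE \<omega> in M. W 0 \<omega> = 0) \<and>
     (AE \<omega> in M. continuous_on {0..T} (\<lambda>t. W t \<omega>)) \<and>
     (\<forall>s t. 0 \<le> s \<and> s < t \<and> t \<le> T \<longrightarrow>
        distributed M lborel (\<lambda>\<omega>. W t \<omega> - W s \<omega>) (normal_density 0 (sqrt (t - s)))) \<and>
     (\<forall>(n::nat) (t :: nat \<Rightarrow> real).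
        (\<forall>k\<le>n. t k \<in> {0..T}) \<and> (\<forall>k<n. t k < t (Suc k)) \<longrightarrow>
        prob_space.indep_vars M (\<lambda>_. borel) (\<lambda>k \<omega>. W (t (Suc k)) \<omega> - W (t k) \<omega>) {..<n})"

text \<open>Independence of the processes as a family, i.e. of the path-valued random variables.\<close>

definition independent_processes ::
  "'a measure \<Rightarrow> real \<Rightarrow> (nat \<Rightarrow> real \<Rightarrow> 'a \<Rightarrow> real) \<Rightarrow> nat set \<Rightarrow> bool" where
  "independent_processes M T W I \<longleftrightarrow>
     prob_space.indep_vars M (\<lambda>_. PiM {0..T} (\<lambda>_. borel :: real measure))
       (\<lambda>i \<omega>. \<lambda>t\<in>{0..T}. W i t \<omega>) I"

text \<open>
  The index is any real number, so that the library's \<open>stopping_time\<close> applies: for \<open>t \<ge> T\<close> this is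
  the \<open>\<sigma>\<close>-algebra at time \<open>T\<close>, and for \<open>t < 0\<close> it consists of the events of probability 0 or 1.
  A random time with values in \<open>[0,T]\<close> almost surely is therefore a stopping time for this family
  iff it is one for its restriction to \<open>[0,T]\<close>.
\<close>

definition completed_filtration ::
  "'a measure \<Rightarrow> real \<Rightarrow> (real \<Rightarrow> 'a \<Rightarrow> real) \<Rightarrow> real \<Rightarrow> 'a measure" where
  "completed_filtration M T W t =
     sigma (space M)
       ({W s -` B \<inter> space M | s B. s \<in> {0..T} \<and> s \<le> t \<and> B \<in> sets borel} \<union> null_sets M)"

definition stopping_times_from ::
  "'a measure \<Rightarrow> real \<Rightarrow> (real \<Rightarrow> 'a measure) \<Rightarrow> real \<Rightarrow> ('a \<Rightarrow> real) set" where
  "stopping_times_from M T F t = {\<tau>. stopping_time F \<tau> \<and> (AE \<omega> in M. \<tau> \<omega> \<in> {t..T})}"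


section \<open>Spaces of random variables and processes\<close>

definition L2_rv :: "'a measure \<Rightarrow> 'a measure \<Rightarrow> ('a \<Rightarrow> real) set" where
  "L2_rv M G = {X. X \<in> borel_measurable G \<and> integrable M (\<lambda>\<omega>. (X \<omega>)\<^sup>2)}"

definition progressively_measurable ::
  "real \<Rightarrow> (real \<Rightarrow> 'a measure) \<Rightarrow> (real \<Rightarrow> 'a \<Rightarrow> real) \<Rightarrow> bool" where
  "progressively_measurable T F y \<longleftrightarrow>
     (\<forall>t\<in>{0..T}. (\<lambda>(s, \<omega>). y s \<omega>) \<in> borel_measurable (restrict_space borel {0..t} \<Otimes>\<^sub>M F t))"

definition S2c :: "'a measure \<Rightarrow> real \<Rightarrow> (real \<Rightarrow> 'a measure) \<Rightarrow> (real \<Rightarrow> 'a \<Rightarrow> real) set" where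
  "S2c M T F = {y. progressively_measurable T F y \<and>
     (AE \<omega> in M. continuous_on {0..T} (\<lambda>t. y t \<omega>)) \<and>
     (\<integral>\<^sup>+ \<omega>. (SUP u\<in>{0..T}. ennreal (\<bar>y u \<omega>\<bar>\<^sup>2)) \<partial>M) < \<infinity>}"


section \<open>The mean-field optimal stopping problem\<close>

text \<open>
  Essential supremum of a family of random variables: the almost surely least measurable
  almost sure upper bound, unique up to null sets. The library's \<open>esssup\<close> is the essential
  supremum of a single function.
\<close>

definition is_ess_sup :: "'a measure \<Rightarrow> ('a \<Rightarrow> real) set \<Rightarrow> ('a \<Rightarrow> real) \<Rightarrow> bool" where
  "is_ess_sup M \<Phi> Z \<longleftrightarrow>
     Z \<in> borel_measurable M \<and>
     (\<forall>X\<in>\<Phi>. AE \<omega> in M. X \<omega> \<le> Z \<omega>) \<and>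
     (\<forall>Z'\<in>borel_measurable M. (\<forall>X\<in>\<Phi>. AE \<omega> in M. X \<omega> \<le> Z' \<omega>) \<longrightarrow> (AE \<omega> in M. Z \<omega> \<le> Z' \<omega>))"

text \<open>The mean-field argument is the number \<open>E[Y\<^sub>\<tau>]\<close>, not \<open>s \<mapsto> E[Y\<^sub>s]\<close> evaluated at \<open>s = \<tau>\<close>.\<close>

definition mf_payoff ::
  "'a measure \<Rightarrow> real \<Rightarrow> (real \<Rightarrow> real \<Rightarrow> real) \<Rightarrow> ('a \<Rightarrow> real) \<Rightarrow> (real \<Rightarrow> 'a \<Rightarrow> real)
     \<Rightarrow> ('a \<Rightarrow> real) \<Rightarrow> 'a \<Rightarrow> real" where
  "mf_payoff M T h \<xi> Y \<tau> \<omega> =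
     h (Y (\<tau> \<omega>) \<omega>) (\<integral>\<omega>'. Y (\<tau> \<omega>') \<omega>' \<partial>M) * indicator {\<omega>. \<tau> \<omega> < T} \<omega>
       + \<xi> \<omega> * indicator {\<omega>. \<tau> \<omega> = T} \<omega>"

definition mf_value_process ::
  "'a measure \<Rightarrow> real \<Rightarrow> (real \<Rightarrow> 'a measure) \<Rightarrow> (real \<Rightarrow> real \<Rightarrow> real) \<Rightarrow> ('a \<Rightarrow> real)
     \<Rightarrow> (real \<Rightarrow> 'a \<Rightarrow> real) \<Rightarrow> bool" where
  "mf_value_process M T F h \<xi> Y \<longleftrightarrow>
     Y \<in> S2c M T F \<and>
     (\<forall>t\<in>{0..T}. is_ess_sup M
        ((\<lambda>\<tau>. real_cond_exp M (F t) (mf_payoff M T h \<xi> Y \<tau>)) ` stopping_times_from M T F t)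
        (Y t))"

text \<open>
  \<open>inf A \<and> T\<close> for a set of times \<open>A \<subseteq> [0,T]\<close>, with \<open>inf \<emptyset> = \<infinity>\<close>, is \<open>Inf (insert T A)\<close>;
  here \<open>E[Y\<^sub>t]\<close> is taken at the deterministic time \<open>t\<close>.
\<close>

definition mf_hitting_time ::
  "'a measure \<Rightarrow> real \<Rightarrow> (real \<Rightarrow> real \<Rightarrow> real) \<Rightarrow> (real \<Rightarrow> 'a \<Rightarrow> real) \<Rightarrow> 'a \<Rightarrow> real" where
  "mf_hitting_time M T h Y \<omega> =
     Inf (insert T {t\<in>{0..T}. Y t \<omega> = h (Y t \<omega>) (\<integral>\<omega>'. Y t \<omega>' \<partial>M)})"

end

theory Submission
  imports Defs
begin

text \<open>
  Each \<open>Y = Y\<^sup>i\<close> is treated separately, and the reason for optimality is that the problem degenerates: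
  \<open>Y\<close> turns out to have the same expectation at all stopping times, so no stopping time can do better
  than \<open>m = E[\<xi>]\<close>, and the mean-field argument is the constant \<open>m\<close> along every stopping rule. In
  particular \<open>E[Y\<^sub>\<tau>]\<close>, which enters the payoff, and \<open>t \<mapsto> E[Y\<^sub>t]\<close>, which enters the hitting time,
  agree.

  Stopping at a deterministic \<open>t < T\<close> gives \<open>h(Y\<^sub>t, E[Y\<^sub>t]) \<le> Y\<^sub>t\<close>. Since paths are continuous up to
  and including \<open>T\<close>, where \<open>Y\<^sub>T = \<xi>\<close>, it follows that \<open>h(\<xi>, m) \<le> \<xi>\<close>
  (\<open>terminal_ge_obstacle\<close>). As \<open>h(\<cdot>, m)\<close> is a contraction, this says
  that \<open>\<xi> \<ge> b\<close>, where the barrier \<open>b\<close> is its fixed point. Never stopping before \<open>T\<close> gives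
  \<open>Y\<^sub>t \<ge> E[\<xi> | F\<^sub>t]\<close>, so \<open>Y \<ge> b\<close> on all of \<open>[0,T]\<close>.

  For the converse estimate, suppose that \<open>Y\<^sub>t \<le> E[\<xi> + R | F\<^sub>t]\<close> for all \<open>t\<close> and some integrable
  \<open>R \<ge> 0\<close>. This passes to stopping times (\<open>sampling_le\<close>), and there the Lipschitz bound around \<open>(b, m)\<close>
  dominates the payoff before \<open>T\<close> by
  \<open>(1 - \<gamma>\<^sub>1) b + \<gamma>\<^sub>1 (\<xi> + R) + \<gamma>\<^sub>2 E[R] \<le> \<xi> + \<gamma>\<^sub>1 R + \<gamma>\<^sub>2 E[R]\<close> in conditional mean. Because the
  essential supremum is the least upper bound, \<open>R\<close> may be replaced by \<open>\<gamma>\<^sub>1 R + \<gamma>\<^sub>2 E[R]\<close>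
  (\<open>excess_bound_step\<close>), whose mean is smaller by the factor \<open>\<gamma>\<^sub>1 + \<gamma>\<^sub>2 < 1\<close>. Iteration gives
  \<open>E[Y\<^sub>\<tau>] = m\<close> for all \<open>\<tau>\<close> (\<open>stopped_expectation_eq\<close>).

  Above the barrier \<open>h(y, m) \<le> y\<close>, with equality only at \<open>y = b\<close>. So the payoff of any \<open>\<tau>\<close> is at most
  \<open>Y\<^sub>\<tau>\<close>, with mean \<open>m\<close>, while the hitting time stops either at \<open>T\<close> or when \<open>Y = b\<close>, where
  the payoff equals \<open>Y\<close>.
\<close>

section \<open>Conditional expectations, null sets and continuous paths\<close>

lemma (in complete_measure) measurable_AE_eq:
  assumes f: "f \<in> measurable M N" and ae: "AE x in M. f x = g x"
    and g: "\<And>x. x \<in> space M \<Longrightarrow> g x \<in> space N"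
  shows "g \<in> measurable M N"
proof (rule measurableI)
  fix A assume A: "A \<in> sets N"
  show "g -` A \<inter> space M \<in> sets M"
  proof (rule in_sets_AE)
    show "AE x in M. x \<in> f -` A \<inter> space M \<longleftrightarrow> x \<in> g -` A \<inter> space M"
      using ae by eventually_elim auto
  qed (use f A in \<open>auto intro: measurable_sets\<close>)
qed (use g in auto)

text \<open>Otherwise the event on which the first conditional expectation exceeds the second, which lies in
  the smaller \<open>\<sigma>\<close>-algebra, would have integrals in the wrong order.\<close>

lemma (in sigma_finite_subalgebra) real_cond_exp_le_of_set_integral_le:
  fixes f g :: "'a \<Rightarrow> real"
  assumes f: "integrable M f" and g: "integrable M g"
    and le: "\<And>A. A \<in> sets F \<Longrightarrow> (\<integral>x\<in>A. f x \<partial>M) \<le> (\<integral>x\<in>A. g x \<partial>M)"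
  shows "AE x in M. real_cond_exp M F f x \<le> real_cond_exp M F g x"
proof -
  let ?f = "real_cond_exp M F f" and ?g = "real_cond_exp M F g"
  define A where "A = {x \<in> space F. ?g x < ?f x}"
  have A: "A \<in> sets F" unfolding A_def by measurable
  have AM: "A \<in> sets M" using A subalg by (auto simp: subalgebra_def)
  have i: "integrable M ?f" "integrable M ?g" using f g by (auto intro: real_cond_exp_int)
  have si: "set_integrable M A ?f" "set_integrable M A ?g"
    unfolding set_integrable_def by (intro integrable_mult_indicator i AM)+
  have "(\<integral>x\<in>A. ?f x - ?g x \<partial>M) = (\<integral>x\<in>A. f x \<partial>M) - (\<integral>x\<in>A. g x \<partial>M)"
    by (simp add: set_integral_diff(2)[OF si] real_cond_exp_intA[OF f A] real_cond_exp_intA[OF g A])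
  then have "(\<integral>x. indicator A x *\<^sub>R (?f x - ?g x) \<partial>M) \<le> 0"
    using le[OF A] by (simp add: set_lebesgue_integral_def)
  moreover have nn: "AE x in M. 0 \<le> indicator A x *\<^sub>R (?f x - ?g x)"
    by (auto simp: A_def indicator_def)
  moreover have ii: "integrable M (\<lambda>x. indicator A x *\<^sub>R (?f x - ?g x))"
    using i AM by (intro integrable_mult_indicator) auto
  ultimately have "(\<integral>x. indicator A x *\<^sub>R (?f x - ?g x) \<partial>M) = 0"
    using integral_nonneg_AE[OF nn] by linarith
  then have "AE x in M. indicator A x *\<^sub>R (?f x - ?g x) = 0"
    using integral_nonneg_eq_0_iff_AE[OF ii nn] by simp
  then show ?thesis
  proof (rule AE_mp, intro AE_I2 impI)
    fix x assume "x \<in> space M" "indicator A x *\<^sub>R (?f x - ?g x) = 0"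
    moreover have "space F = space M" using subalg by (simp add: subalgebra_def)
    ultimately show "?f x \<le> ?g x" by (cases "x \<in> A") (auto simp: A_def)
  qed
qed

text \<open>Almost sure membership at a countable dense set of times extends to all times by continuity; this
  exchanges the quantifier over uncountably many times with the almost sure one.\<close>

lemma AE_interval_in_closed:
  fixes Y :: "real \<Rightarrow> 'a \<Rightarrow> real"
  assumes cont: "AE \<omega> in M. continuous_on {a..b} (\<lambda>t. Y t \<omega>)" and C: "closed C"
    and ae: "\<And>t. t \<in> {a..b} \<Longrightarrow> AE \<omega> in M. Y t \<omega> \<in> C"
  shows "AE \<omega> in M. \<forall>t\<in>{a..b}. Y t \<omega> \<in> C"
proof -
  obtain D :: "real set" where D: "countable D" "D \<subseteq> {a..b}" "{a..b} \<subseteq> closure D"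
    using separable by blast
  have cl: "closure D = {a..b}" using D closure_minimal[OF D(2)] by auto
  have "AE \<omega> in M. \<forall>t\<in>D. Y t \<omega> \<in> C"
    using D ae by (subst AE_ball_countable) auto
  with cont show ?thesis
  proof eventually_elim
    case (elim \<omega>)
    have "(\<lambda>t. Y t \<omega>) ` closure D \<subseteq> C"
      by (rule image_closure_subset) (use elim C cl in auto)
    then show ?case using cl by auto
  qed
qed

section \<open>Stopping times on a grid\<close>

text \<open>Every event of the filtration may be modified on a null set, so almost sure properties of
  paths and stopping times can be used to decide measurability at time \<open>t\<close>.\<close>

locale complete_filtration = prob_space M + complete_measure M
  for M :: "'a measure" +
  fixes T :: real and F :: "real \<Rightarrow> 'a measure"
  assumes T_pos: "0 < T"
    and subalgebra_F: "subalgebra M (F t)"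
    and F_mono: "s \<le> t \<Longrightarrow> sets (F s) \<subseteq> sets (F t)"
    and null_sets_F: "null_sets M \<subseteq> sets (F t)"
begin

sublocale ce: sigma_finite_subalgebra M "F t" for t
proof -
  have "finite_measure_subalgebra M (F t)"
    by unfold_locales (rule subalgebra_F)
  then show "sigma_finite_subalgebra M (F t)"
    by (rule finite_measure_subalgebra_is_sigma_finite)
qed

lemma space_F: "space (F t) = space M"
  using subalgebra_F by (simp add: subalgebra_def)

lemma sets_F_M: "A \<in> sets (F t) \<Longrightarrow> A \<in> sets M"
  using subalgebra_F[of t] by (auto simp: subalgebra_def)

lemma measurable_F_M: "f \<in> measurable (F t) N \<Longrightarrow> f \<in> measurable M N"
  by (rule measurable_from_subalg[OF subalgebra_F])

lemma sets_F_AE_eq: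
  assumes A: "A \<in> sets (F t)" and ae: "AE \<omega> in M. \<omega> \<in> A \<longleftrightarrow> \<omega> \<in> B" and B: "B \<subseteq> space M"
  shows "B \<in> sets (F t)"
proof -
  have BM: "B \<in> sets M" by (rule in_sets_AE[OF ae sets_F_M[OF A] B])
  have "B - A \<in> null_sets M" "A - B \<in> null_sets M"
    using ae BM sets_F_M[OF A] by (auto simp: null_sets_iff_AE dest: sets.sets_into_space)
  then have "A \<union> (B - A) - (A - B) \<in> sets (F t)" using null_sets_F A by blast
  moreover have "A \<union> (B - A) - (A - B) = B" by auto
  ultimately show ?thesis by simp
qed

lemma stopping_time_sets: "stopping_time F \<tau> \<Longrightarrow> {\<omega> \<in> space M. \<tau> \<omega> \<le> s} \<in> sets (F s)"
  by (auto dest!: stopping_timeD[of F \<tau> s] simp: pred_def space_F)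

lemma stopping_time_measurable: "stopping_time F \<tau> \<Longrightarrow> \<tau> \<in> borel_measurable M"
  by (intro borel_measurableI_le) (auto intro: sets_F_M stopping_time_sets)

text \<open>Rounding up to a grid of mesh \<open>T / (n + 1)\<close> turns a stopping time into one with finitely many
  values, and rounding up rather than down keeps the event that the rounded time equals \<open>p\<close> in
  \<open>F p\<close>.\<close>

definition grid :: "nat \<Rightarrow> real \<Rightarrow> real" where
  "grid n x = T * of_int \<lceil>real (Suc n) * x / T\<rceil> / real (Suc n)"

definition grid_points :: "nat \<Rightarrow> real set" where
  "grid_points n = (\<lambda>k. T * real k / real (Suc n)) ` {..Suc n}"

lemma finite_grid_points: "finite (grid_points n)"
  by (simp add: grid_points_def)

lemma grid_points_subset: "grid_points n \<subseteq> {0..T}"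
  using T_pos by (auto simp: grid_points_def field_simps simp del: of_nat_Suc)

lemma grid_in_points:
  assumes "x \<in> {0..T}" shows "grid n x \<in> grid_points n"
proof -
  define k where "k = \<lceil>real (Suc n) * x / T\<rceil>"
  have "0 \<le> real (Suc n) * x / T" "real (Suc n) * x / T \<le> real (Suc n)"
    using assms T_pos by (auto simp: divide_le_eq simp del: of_nat_Suc)
  then have k: "0 \<le> k" "k \<le> int (Suc n)"
    unfolding k_def by (simp_all add: ceiling_le_iff le_ceiling_iff)
  then have "grid n x = T * real (nat k) / real (Suc n)" by (simp add: grid_def k_def)
  then show ?thesis using k unfolding grid_points_def by (intro image_eqI[of _ _ "nat k"]) auto
qed

lemma grid_eq_iff:
  assumes "p \<in> grid_points n"
  shows "grid n x = p \<longleftrightarrow> p - T / real (Suc n) < x \<and> x \<le> p"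
proof -
  obtain k where p: "p = T * real k / real (Suc n)" using assms by (auto simp: grid_points_def)
  have "grid n x = p \<longleftrightarrow> \<lceil>real (Suc n) * x / T\<rceil> = int k"
    using T_pos by (auto simp: grid_def p simp del: of_nat_Suc)
  also have "\<dots> \<longleftrightarrow> real k - 1 < real (Suc n) * x / T \<and> real (Suc n) * x / T \<le> real k"
    by (simp add: ceiling_eq_iff)
  also have "\<dots> \<longleftrightarrow> p - T / real (Suc n) < x \<and> x \<le> p"
    using T_pos by (auto simp: p field_simps simp del: of_nat_Suc)
  finally show ?thesis .
qed

lemma grid_tendsto:
  assumes "x \<in> {0..T}" shows "(\<lambda>n. grid n x) \<longlonglongrightarrow> x"
proof (rule tendsto_sandwich)
  have *: "grid n x - T / real (Suc n) < x \<and> x \<le> grid n x" for n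
    using grid_eq_iff[OF grid_in_points[OF assms], of n x] by simp
  show "\<forall>\<^sub>F n in sequentially. x \<le> grid n x" using * by simp
  show "\<forall>\<^sub>F n in sequentially. grid n x \<le> x + T * inverse (real (Suc n))"
    using * by (intro always_eventually allI) (smt (verit) divide_inverse)
  show "(\<lambda>n. x + T * inverse (real (Suc n))) \<longlonglongrightarrow> x"
    using tendsto_add[OF tendsto_const tendsto_mult_right_zero[OF LIMSEQ_inverse_real_of_nat], of x T]
    by simp
qed simp

text \<open>The hypothesis says that \<open>B\<close> belongs to the \<open>\<sigma>\<close>-algebra of events prior to \<open>\<tau>\<close>.\<close>

lemma sets_grid_eq:
  assumes B: "\<And>s. {\<omega>\<in>B. \<tau> \<omega> \<le> s} \<in> sets (F s)" and p: "p \<in> grid_points n"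
  shows "{\<omega>\<in>B. grid n (\<tau> \<omega>) = p} \<in> sets (F p)"
proof -
  have "p - T / real (Suc n) \<le> p" using T_pos by simp
  from F_mono[OF this] B have "{\<omega>\<in>B. \<tau> \<omega> \<le> p - T / real (Suc n)} \<in> sets (F p)" by blast
  with B[of p] have "{\<omega>\<in>B. \<tau> \<omega> \<le> p} - {\<omega>\<in>B. \<tau> \<omega> \<le> p - T / real (Suc n)} \<in> sets (F p)" by blast
  also have "{\<omega>\<in>B. \<tau> \<omega> \<le> p} - {\<omega>\<in>B. \<tau> \<omega> \<le> p - T / real (Suc n)} = {\<omega>\<in>B. grid n (\<tau> \<omega>) = p}"
    by (auto simp: grid_eq_iff[OF p])
  finally show ?thesis .
qed

end

section \<open>Sampling a dominated continuous process at a stopping time\<close>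

locale continuous_adapted_process = complete_filtration +
  fixes Y :: "real \<Rightarrow> 'a \<Rightarrow> real" and S :: "'a \<Rightarrow> real"
  assumes adapted: "t \<in> {0..T} \<Longrightarrow> Y t \<in> borel_measurable (F t)"
    and continuous_paths: "AE \<omega> in M. continuous_on {0..T} (\<lambda>t. Y t \<omega>)"
    and integrable_S: "integrable M S"
    and dominated: "AE \<omega> in M. \<forall>t\<in>{0..T}. \<bar>Y t \<omega>\<bar> \<le> S \<omega>"
begin

lemma Y_measurable: "t \<in> {0..T} \<Longrightarrow> Y t \<in> borel_measurable M"
  using adapted measurable_F_M by blast

lemma integrable_Y:
  assumes "t \<in> {0..T}" shows "integrable M (Y t)"
proof (rule Bochner_Integration.integrable_bound[OF integrable_S Y_measurable[OF assms]])
  show "AE x in M. norm (Y t x) \<le> norm (S x)"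
    using dominated by eventually_elim (use assms in force)
qed

text \<open>This reduces statements about \<open>Y\<close> at the rounded stopping time to the finitely many
  deterministic times of the grid.\<close>

lemma grid_sum_eq:
  assumes \<tau>: "AE \<omega> in M. \<tau> \<omega> \<in> {0..T}"
  shows "AE \<omega> in M. indicator B \<omega> *\<^sub>R X (grid n (\<tau> \<omega>)) \<omega> =
    (\<Sum>p\<in>grid_points n. indicator {\<omega>\<in>B. grid n (\<tau> \<omega>) = p} \<omega> *\<^sub>R (X p \<omega> :: real))"
  using \<tau>
proof eventually_elim
  case (elim \<omega>)
  have "(\<Sum>p\<in>grid_points n. indicator {\<omega>\<in>B. grid n (\<tau> \<omega>) = p} \<omega> *\<^sub>R X p \<omega>) =
    (\<Sum>p\<in>grid_points n. if grid n (\<tau> \<omega>) = p then indicator B \<omega> *\<^sub>R X p \<omega> else 0)"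
    by (intro sum.cong) (auto simp: indicator_def)
  then show ?case using grid_in_points[OF elim, of n] by (simp add: finite_grid_points)
qed

lemma stopped_grid_measurable:
  assumes \<tau>: "AE \<omega> in M. \<tau> \<omega> \<in> {0..T}" and B: "\<And>s. {\<omega>\<in>B. \<tau> \<omega> \<le> s} \<in> sets (F s)"
  shows "(\<lambda>\<omega>. indicator B \<omega> *\<^sub>R Y (grid n (\<tau> \<omega>)) \<omega>) \<in> borel_measurable M"
proof (rule measurable_AE_eq)
  show "AE \<omega> in M. (\<Sum>p\<in>grid_points n. indicator {\<omega>\<in>B. grid n (\<tau> \<omega>) = p} \<omega> *\<^sub>R Y p \<omega>)
      = indicator B \<omega> *\<^sub>R Y (grid n (\<tau> \<omega>)) \<omega>"
    using grid_sum_eq[OF \<tau>, of B Y n] by eventually_elim simp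
  have "{\<omega>\<in>B. grid n (\<tau> \<omega>) = p} \<in> sets M" "Y p \<in> borel_measurable M" if "p \<in> grid_points n" for p
    using sets_F_M sets_grid_eq[OF B that] Y_measurable that grid_points_subset by blast+
  then show "(\<lambda>\<omega>. \<Sum>p\<in>grid_points n. indicator {\<omega>\<in>B. grid n (\<tau> \<omega>) = p} \<omega> *\<^sub>R Y p \<omega>) \<in> borel_measurable M"
    by (intro borel_measurable_sum borel_measurable_scaleR borel_measurable_indicator)
qed simp

lemma stopped_grid_tendsto:
  assumes \<tau>: "AE \<omega> in M. \<tau> \<omega> \<in> {0..T}"
  shows "AE \<omega> in M. (\<lambda>n. indicator B \<omega> *\<^sub>R Y (grid n (\<tau> \<omega>)) \<omega>) \<longlonglongrightarrow> indicator B \<omega> *\<^sub>R Y (\<tau> \<omega>) \<omega>"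
  using \<tau> continuous_paths
proof eventually_elim
  case (elim \<omega>)
  have "\<And>n. grid n (\<tau> \<omega>) \<in> {0..T}" using grid_in_points[OF elim(1)] grid_points_subset by blast
  then have "(\<lambda>n. Y (grid n (\<tau> \<omega>)) \<omega>) \<longlonglongrightarrow> Y (\<tau> \<omega>) \<omega>"
    using elim grid_tendsto[OF elim(1)]
    by (intro continuous_on_tendsto_compose[OF elim(2)]) auto
  then show ?case by (intro tendsto_intros)
qed

lemma stopped_set_measurable:
  assumes \<tau>: "AE \<omega> in M. \<tau> \<omega> \<in> {0..T}" and B: "\<And>s. {\<omega>\<in>B. \<tau> \<omega> \<le> s} \<in> sets (F s)"
  shows "(\<lambda>\<omega>. indicator B \<omega> *\<^sub>R Y (\<tau> \<omega>) \<omega>) \<in> borel_measurable M"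
proof (rule measurable_AE_eq)
  let ?L = "\<lambda>\<omega>. lim (\<lambda>n. indicator B \<omega> *\<^sub>R Y (grid n (\<tau> \<omega>)) \<omega>)"
  show "?L \<in> borel_measurable M"
    by (intro borel_measurable_lim_metric stopped_grid_measurable[OF assms])
  show "AE \<omega> in M. ?L \<omega> = indicator B \<omega> *\<^sub>R Y (\<tau> \<omega>) \<omega>"
    using stopped_grid_tendsto[OF \<tau>, of B] by eventually_elim (rule limI)
qed simp

lemma stopped_measurable:
  assumes "stopping_time F \<tau>" "AE \<omega> in M. \<tau> \<omega> \<in> {0..T}"
  shows "(\<lambda>\<omega>. Y (\<tau> \<omega>) \<omega>) \<in> borel_measurable M"
proof -
  have "(\<lambda>\<omega>. indicator (space M) \<omega> *\<^sub>R Y (\<tau> \<omega>) \<omega>) \<in> borel_measurable M"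
    by (rule stopped_set_measurable) (use assms stopping_time_sets in auto)
  then show ?thesis by (rule measurable_cong[THEN iffD1, rotated]) auto
qed

lemma stopped_dominated:
  assumes "AE \<omega> in M. \<tau> \<omega> \<in> {0..T}"
  shows "AE \<omega> in M. \<bar>Y (\<tau> \<omega>) \<omega>\<bar> \<le> S \<omega>"
  using assms dominated by eventually_elim blast

lemma stopped_integrable:
  assumes "stopping_time F \<tau>" "AE \<omega> in M. \<tau> \<omega> \<in> {0..T}"
  shows "integrable M (\<lambda>\<omega>. Y (\<tau> \<omega>) \<omega>)"
  by (rule Bochner_Integration.integrable_bound[OF integrable_S stopped_measurable[OF assms]])
    (use stopped_dominated[OF assms(2)] in \<open>eventually_elim, simp\<close>)

text \<open>A one-sided optional sampling theorem for \<open>Y\<^sub>t \<le> E[X | F\<^sub>t]\<close>, with the hypothesis in integrated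
  form. At the rounded stopping times it is a sum over the grid points; the limit exists by path
  continuity of \<open>Y\<close> and domination. Only \<open>Y\<close> is evaluated at random times; \<open>E[X | F\<^sub>t]\<close> may
  lack a continuous version.\<close>

theorem sampling_le:
  assumes X: "integrable M X"
    and le: "\<And>t A. t \<in> {0..T} \<Longrightarrow> A \<in> sets (F t) \<Longrightarrow> (\<integral>\<omega>\<in>A. Y t \<omega> \<partial>M) \<le> (\<integral>\<omega>\<in>A. X \<omega> \<partial>M)"
    and \<tau>: "AE \<omega> in M. \<tau> \<omega> \<in> {0..T}" and B: "\<And>s. {\<omega>\<in>B. \<tau> \<omega> \<le> s} \<in> sets (F s)"
    and BM: "B \<in> sets M"
  shows "(\<integral>\<omega>\<in>B. Y (\<tau> \<omega>) \<omega> \<partial>M) \<le> (\<integral>\<omega>\<in>B. X \<omega> \<partial>M)"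
proof (rule LIMSEQ_le_const2)
  let ?A = "\<lambda>n p. {\<omega>\<in>B. grid n (\<tau> \<omega>) = p}"
  show "(\<lambda>n. \<integral>\<omega>\<in>B. Y (grid n (\<tau> \<omega>)) \<omega> \<partial>M) \<longlonglongrightarrow> (\<integral>\<omega>\<in>B. Y (\<tau> \<omega>) \<omega> \<partial>M)"
    unfolding set_lebesgue_integral_def
  proof (rule integral_dominated_convergence[OF _ _ integrable_S stopped_grid_tendsto[OF \<tau>]])
    show "(\<lambda>\<omega>. indicat_real B \<omega> *\<^sub>R Y (\<tau> \<omega>) \<omega>) \<in> borel_measurable M"
      by (rule stopped_set_measurable[OF \<tau> B])
    fix n
    show "(\<lambda>\<omega>. indicat_real B \<omega> *\<^sub>R Y (grid n (\<tau> \<omega>)) \<omega>) \<in> borel_measurable M"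
      by (rule stopped_grid_measurable[OF \<tau> B])
    show "AE \<omega> in M. norm (indicat_real B \<omega> *\<^sub>R Y (grid n (\<tau> \<omega>)) \<omega>) \<le> S \<omega>"
      using \<tau> dominated
    proof eventually_elim
      case (elim \<omega>)
      have "grid n (\<tau> \<omega>) \<in> {0..T}" using grid_in_points[OF elim(1)] grid_points_subset by blast
      with elim(2) have "\<bar>Y (grid n (\<tau> \<omega>)) \<omega>\<bar> \<le> S \<omega>" by blast
      then show ?case by (auto simp: indicator_def)
    qed
  qed
  have "(\<integral>\<omega>\<in>B. Y (grid n (\<tau> \<omega>)) \<omega> \<partial>M) \<le> (\<integral>\<omega>\<in>B. X \<omega> \<partial>M)" for n
  proof -
    have p: "?A n p \<in> sets (F p)" "?A n p \<in> sets M" "p \<in> {0..T}" if "p \<in> grid_points n" for p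
      using sets_F_M sets_grid_eq[OF B that] that grid_points_subset by blast+
    have "(\<integral>\<omega>\<in>B. Y (grid n (\<tau> \<omega>)) \<omega> \<partial>M)
        = (\<integral>\<omega>. (\<Sum>p\<in>grid_points n. indicator (?A n p) \<omega> *\<^sub>R Y p \<omega>) \<partial>M)"
      unfolding set_lebesgue_integral_def
    proof (intro integral_cong_AE stopped_grid_measurable[OF \<tau> B] grid_sum_eq[OF \<tau>])
      show "(\<lambda>\<omega>. \<Sum>p\<in>grid_points n. indicator (?A n p) \<omega> *\<^sub>R Y p \<omega>) \<in> borel_measurable M"
        using p Y_measurable
        by (intro borel_measurable_sum borel_measurable_scaleR borel_measurable_indicator) auto
    qed
    also have "\<dots> = (\<Sum>p\<in>grid_points n. \<integral>\<omega>\<in>?A n p. Y p \<omega> \<partial>M)"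
      unfolding set_lebesgue_integral_def
      by (intro Bochner_Integration.integral_sum integrable_mult_indicator p integrable_Y)
    also have "\<dots> \<le> (\<Sum>p\<in>grid_points n. \<integral>\<omega>\<in>?A n p. X \<omega> \<partial>M)"
      by (intro sum_mono le p)
    also have "\<dots> = (\<integral>\<omega>. (\<Sum>p\<in>grid_points n. indicator (?A n p) \<omega> *\<^sub>R X \<omega>) \<partial>M)"
      unfolding set_lebesgue_integral_def
      by (intro Bochner_Integration.integral_sum[symmetric] integrable_mult_indicator p X)
    also have "\<dots> = (\<integral>\<omega>\<in>B. X \<omega> \<partial>M)"
      unfolding set_lebesgue_integral_def
    proof (intro integral_cong_AE)
      show "(\<lambda>\<omega>. \<Sum>p\<in>grid_points n. indicator (?A n p) \<omega> *\<^sub>R X \<omega>) \<in> borel_measurable M"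
        using p X
        by (intro borel_measurable_sum borel_measurable_scaleR borel_measurable_indicator) auto
      show "(\<lambda>\<omega>. indicat_real B \<omega> *\<^sub>R X \<omega>) \<in> borel_measurable M"
        using X BM by measurable
      show "AE \<omega> in M. (\<Sum>p\<in>grid_points n. indicat_real (?A n p) \<omega> *\<^sub>R X \<omega>) = indicat_real B \<omega> *\<^sub>R X \<omega>"
        using grid_sum_eq[OF \<tau>, of B "\<lambda>_. X" n] by eventually_elim simp
    qed
    finally show ?thesis .
  qed
  then show "\<exists>N. \<forall>n\<ge>N. (\<integral>\<omega>\<in>B. Y (grid n (\<tau> \<omega>)) \<omega> \<partial>M) \<le> (\<integral>\<omega>\<in>B. X \<omega> \<partial>M)" by blast
qed

end

section \<open>The value process lies above a constant barrier\<close>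

locale mean_field_value = continuous_adapted_process +
  fixes \<xi> :: "'a \<Rightarrow> real" and h :: "real \<Rightarrow> real \<Rightarrow> real" and \<gamma>\<^sub>1 \<gamma>\<^sub>2 :: real
  assumes xi_measurable: "\<xi> \<in> borel_measurable (F T)" and xi_integrable: "integrable M \<xi>"
    and gamma_nonneg: "0 \<le> \<gamma>\<^sub>1" "0 \<le> \<gamma>\<^sub>2" and gamma_less: "\<gamma>\<^sub>1 + \<gamma>\<^sub>2 < 1"
    and lipschitz: "\<bar>h y\<^sub>1 z\<^sub>1 - h y\<^sub>2 z\<^sub>2\<bar> \<le> \<gamma>\<^sub>1 * \<bar>y\<^sub>1 - y\<^sub>2\<bar> + \<gamma>\<^sub>2 * \<bar>z\<^sub>1 - z\<^sub>2\<bar>"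
    and value_ess_sup: "t \<in> {0..T} \<Longrightarrow> is_ess_sup M
        ((\<lambda>\<tau>. real_cond_exp M (F t) (mf_payoff M T h \<xi> Y \<tau>)) ` stopping_times_from M T F t) (Y t)"
begin

abbreviation "payoff \<equiv> mf_payoff M T h \<xi> Y"
abbreviation "stopping_from \<equiv> stopping_times_from M T F"
abbreviation "m \<equiv> expectation \<xi>"

lemma stopping_fromD:
  assumes "\<tau> \<in> stopping_from t" "0 \<le> t"
  shows "stopping_time F \<tau>" "AE \<omega> in M. \<tau> \<omega> \<in> {0..T}" "AE \<omega> in M. \<tau> \<omega> \<in> {t..T}"
  using assms by (auto simp: stopping_times_from_def elim: AE_mp)

lemma const_stopping_from: "t \<le> s \<Longrightarrow> s \<le> T \<Longrightarrow> (\<lambda>_. s) \<in> stopping_from t"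
  by (simp add: stopping_times_from_def stopping_time_const)

lemma h_measurable: "(\<lambda>y. h y z) \<in> borel_measurable borel"
proof (intro borel_measurable_continuous_onI continuous_onI)
  fix y e :: real assume "0 < e"
  show "\<exists>d>0. \<forall>y'\<in>UNIV. dist y' y < d \<longrightarrow> dist (h y' z) (h y z) \<le> e"
  proof (intro exI[of _ e] conjI ballI impI)
    fix y' assume "dist y' y < e"
    moreover have "\<gamma>\<^sub>1 * \<bar>y' - y\<bar> \<le> 1 * \<bar>y' - y\<bar>"
      using gamma_nonneg gamma_less by (intro mult_right_mono) auto
    ultimately show "dist (h y' z) (h y z) \<le> e"
      using lipschitz[of y' z y z] by (simp add: dist_real_def)
  qed fact
qed

lemma h_integrable:
  assumes X: "integrable M X" shows "integrable M (\<lambda>\<omega>. h (X \<omega>) z)"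
proof (rule Bochner_Integration.integrable_bound)
  show "integrable M (\<lambda>\<omega>. \<bar>h 0 z\<bar> + \<gamma>\<^sub>1 * \<bar>X \<omega>\<bar>)" using X by auto
  show "(\<lambda>\<omega>. h (X \<omega>) z) \<in> borel_measurable M"
    using measurable_compose[OF _ h_measurable] X by auto
  show "AE \<omega> in M. norm (h (X \<omega>) z) \<le> norm (\<bar>h 0 z\<bar> + \<gamma>\<^sub>1 * \<bar>X \<omega>\<bar>)"
  proof (rule AE_I2)
    fix \<omega> show "norm (h (X \<omega>) z) \<le> norm (\<bar>h 0 z\<bar> + \<gamma>\<^sub>1 * \<bar>X \<omega>\<bar>)"
      using lipschitz[of "X \<omega>" z 0 z] by simp
  qed
qed

lemma payoff_integrable:
  assumes \<tau>: "stopping_time F \<tau>" "AE \<omega> in M. \<tau> \<omega> \<in> {0..T}"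
  shows "integrable M (payoff \<tau>)"
proof -
  have [measurable]: "\<tau> \<in> borel_measurable M" by (rule stopping_time_measurable[OF \<tau>(1)])
  define A where "A = {\<omega>\<in>space M. \<tau> \<omega> < T}"
  define B where "B = {\<omega>\<in>space M. \<tau> \<omega> = T}"
  have "A \<in> sets M" "B \<in> sets M" by (simp_all add: A_def B_def)
  then have "integrable M (\<lambda>\<omega>. h (Y (\<tau> \<omega>) \<omega>) (expectation (\<lambda>\<omega>'. Y (\<tau> \<omega>') \<omega>')) * indicator A \<omega>
      + \<xi> \<omega> * indicator B \<omega>)"
    by (intro Bochner_Integration.integrable_add integrable_real_mult_indicator h_integrable
        stopped_integrable \<tau> xi_integrable)
  then show ?thesis
    by (rule Bochner_Integration.integrable_cong[THEN iffD1, rotated -1])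
       (auto simp: mf_payoff_def A_def B_def indicator_def)
qed

lemma value_ge_cond_exp:
  assumes "t \<in> {0..T}" "\<tau> \<in> stopping_from t"
  shows "AE \<omega> in M. real_cond_exp M (F t) (payoff \<tau>) \<omega> \<le> Y t \<omega>"
  using value_ess_sup[OF assms(1)] assms(2) by (auto simp: is_ess_sup_def)

lemma payoff_T: "payoff (\<lambda>_. T) = \<xi>"
  by (auto simp: mf_payoff_def)

text \<open>At time \<open>T\<close> the only choice is to stop, almost surely, and \<open>\<xi>\<close> is already known.\<close>

lemma value_terminal: "AE \<omega> in M. Y T \<omega> = \<xi> \<omega>"
proof -
  have T: "T \<in> {0..T}" using T_pos by simp
  have xi: "AE \<omega> in M. real_cond_exp M (F T) \<xi> \<omega> = \<xi> \<omega>"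
    by (rule ce.real_cond_exp_F_meas[OF xi_integrable xi_measurable])
  have le: "AE \<omega> in M. real_cond_exp M (F T) (payoff \<tau>) \<omega> \<le> \<xi> \<omega>" if \<tau>: "\<tau> \<in> stopping_from T" for \<tau>
  proof -
    have "AE \<omega> in M. payoff \<tau> \<omega> = \<xi> \<omega>"
      using stopping_fromD(3)[OF \<tau>] T_pos by (auto simp: mf_payoff_def elim!: AE_mp)
    then have "AE \<omega> in M. real_cond_exp M (F T) (payoff \<tau>) \<omega> = real_cond_exp M (F T) \<xi> \<omega>"
      using stopping_fromD[OF \<tau>] T_pos xi_integrable
      by (intro ce.real_cond_exp_cong borel_measurable_integrable payoff_integrable) auto
    with xi show ?thesis by eventually_elim simp
  qed
  have "AE \<omega> in M. Y T \<omega> \<le> \<xi> \<omega>"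
    using value_ess_sup[OF T] le borel_measurable_integrable[OF xi_integrable] unfolding is_ess_sup_def by blast
  moreover have "AE \<omega> in M. real_cond_exp M (F T) \<xi> \<omega> \<le> Y T \<omega>"
    using value_ge_cond_exp[OF T const_stopping_from[of T T]] by (simp add: payoff_T)
  ultimately show ?thesis using xi by eventually_elim simp
qed

text \<open>Compare with stopping at \<open>T\<close>.\<close>

lemma value_ge_cond_exp_xi:
  assumes "t \<in> {0..T}"
  shows "AE \<omega> in M. real_cond_exp M (F t) \<xi> \<omega> \<le> Y t \<omega>"
  using value_ge_cond_exp[OF assms const_stopping_from[of t T]] assms by (simp add: payoff_T)

text \<open>Compare with stopping at once, where the mean-field argument is \<open>E[Y\<^sub>t]\<close>.\<close>

lemma value_ge_obstacle:
  assumes t: "0 \<le> t" "t < T"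
  shows "AE \<omega> in M. h (Y t \<omega>) (expectation (Y t)) \<le> Y t \<omega>"
proof -
  have p: "payoff (\<lambda>_. t) = (\<lambda>\<omega>. h (Y t \<omega>) (expectation (Y t)))"
    using t by (auto simp: mf_payoff_def)
  have "AE \<omega> in M. real_cond_exp M (F t) (\<lambda>\<omega>. h (Y t \<omega>) (expectation (Y t))) \<omega>
      = h (Y t \<omega>) (expectation (Y t))"
    using t by (intro ce.real_cond_exp_F_meas h_integrable integrable_Y
        measurable_compose[OF adapted h_measurable]) auto
  moreover have "AE \<omega> in M. real_cond_exp M (F t) (payoff (\<lambda>_. t)) \<omega> \<le> Y t \<omega>"
    using t by (intro value_ge_cond_exp const_stopping_from) auto
  ultimately show ?thesis unfolding p by eventually_elim simp
qed

text \<open>Let \<open>t\<close> increase to \<open>T\<close> in the preceding inequality. This is where continuity of \<open>Y\<close> at the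
  terminal time forces a compatibility condition between \<open>h\<close> and \<open>\<xi>\<close>.\<close>

lemma terminal_ge_obstacle: "AE \<omega> in M. h (\<xi> \<omega>) m \<le> \<xi> \<omega>"
proof -
  define t where "t n = T - T * inverse (real (Suc n))" for n
  have t: "0 \<le> t n" "t n < T" for n
    using T_pos by (auto simp: t_def field_simps)
  have tT: "t \<longlonglongrightarrow> T"
    unfolding t_def using tendsto_diff[OF tendsto_const tendsto_mult_right_zero[OF LIMSEQ_inverse_real_of_nat], of T T]
    by simp
  have Yt: "AE \<omega> in M. (\<lambda>n. Y (t n) \<omega>) \<longlonglongrightarrow> \<xi> \<omega>"
    using continuous_paths value_terminal
  proof eventually_elim
    case (elim \<omega>)
    have "(\<lambda>n. Y (t n) \<omega>) \<longlonglongrightarrow> Y T \<omega>"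
      using t T_pos by (intro continuous_on_tendsto_compose[OF elim(1) tT]) (auto intro!: always_eventually less_imp_le)
    then show ?case using elim by simp
  qed
  have Ym: "(\<lambda>n. expectation (Y (t n))) \<longlonglongrightarrow> m"
  proof (rule integral_dominated_convergence[OF _ _ integrable_S Yt])
    fix n
    have tn: "t n \<in> {0..T}" using t[of n] by simp
    show "Y (t n) \<in> borel_measurable M" using Y_measurable[OF tn] .
    show "AE \<omega> in M. norm (Y (t n) \<omega>) \<le> S \<omega>"
      using dominated by eventually_elim (use tn in auto)
  qed (use xi_integrable in auto)
  have "AE \<omega> in M. \<forall>n. h (Y (t n) \<omega>) (expectation (Y (t n))) \<le> Y (t n) \<omega>"
    using value_ge_obstacle[OF t] by (simp add: AE_all_countable)
  with Yt show ?thesis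
  proof eventually_elim
    case (elim \<omega>)
    let ?r = "\<lambda>n. Y (t n) \<omega> + (\<gamma>\<^sub>1 * \<bar>\<xi> \<omega> - Y (t n) \<omega>\<bar> + \<gamma>\<^sub>2 * \<bar>m - expectation (Y (t n))\<bar>)"
    have "?r \<longlonglongrightarrow> \<xi> \<omega> + (\<gamma>\<^sub>1 * \<bar>\<xi> \<omega> - \<xi> \<omega>\<bar> + \<gamma>\<^sub>2 * \<bar>m - m\<bar>)"
      by (intro tendsto_intros elim Ym)
    moreover have "h (\<xi> \<omega>) m \<le> ?r n" for n
      using lipschitz[of "\<xi> \<omega>" m "Y (t n) \<omega>" "expectation (Y (t n))"] elim(2)[rule_format, of n] by linarith
    ultimately show ?case using LIMSEQ_le_const[of ?r _ "h (\<xi> \<omega>) m"] by auto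
  qed
qed

text \<open>The fixed point of the contraction \<open>h(\<cdot>, m)\<close>.\<close>

definition barrier :: real where "barrier = (THE y. h y m = y)"

lemma ex1_barrier: "\<exists>!y. h y m = y"
proof (rule banach_fix_type)
  show "\<forall>x y. dist (h x m) (h y m) \<le> \<gamma>\<^sub>1 * dist x y"
    using lipschitz[of _ m _ m] by (simp add: dist_real_def)
qed (use gamma_nonneg gamma_less in auto)

lemma h_barrier: "h barrier m = barrier"
  unfolding barrier_def by (rule theI'[OF ex1_barrier])

lemma h_eq_iff_barrier: "y = h y m \<longleftrightarrow> y = barrier"
proof
  assume "y = h y m"
  from the1_equality[OF ex1_barrier this[symmetric]] show "y = barrier" by (simp add: barrier_def)
qed (simp add: h_barrier)

text \<open>The Lipschitz bound around the fixed point \<open>(barrier, m)\<close>. Above the barrier the absolute value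
  disappears, so the bound is affine in \<open>y\<close> and can be integrated.\<close>

lemma h_le_above_barrier:
  assumes "barrier \<le> y"
  shows "h y z \<le> (1 - \<gamma>\<^sub>1) * barrier + \<gamma>\<^sub>1 * y + \<gamma>\<^sub>2 * \<bar>z - m\<bar>"
  using lipschitz[of y z barrier m] assms by (simp add: h_barrier algebra_simps)

lemma barrier_le:
  assumes "h y m \<le> y" shows "barrier \<le> y"
proof (rule ccontr)
  assume "\<not> barrier \<le> y"
  then have lt: "0 < barrier - y" by simp
  have "\<bar>h y m - barrier\<bar> \<le> \<gamma>\<^sub>1 * (barrier - y)"
    using lipschitz[of y m barrier m] lt by (simp add: h_barrier)
  moreover have "\<gamma>\<^sub>1 * (barrier - y) < 1 * (barrier - y)"
    using lt gamma_nonneg gamma_less by (intro mult_strict_right_mono) auto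
  moreover have "barrier - h y m \<le> \<bar>h y m - barrier\<bar>" by simp
  ultimately have "barrier - h y m < 1 * (barrier - y)" by (meson le_less_trans order_trans)
  then show False using assms by simp
qed

lemma xi_ge_barrier: "AE \<omega> in M. barrier \<le> \<xi> \<omega>"
  using terminal_ge_obstacle by eventually_elim (rule barrier_le)

lemma value_ge_barrier: "AE \<omega> in M. \<forall>t\<in>{0..T}. barrier \<le> Y t \<omega>"
proof -
  have "AE \<omega> in M. Y t \<omega> \<in> {barrier..}" if t: "t \<in> {0..T}" for t
    using ce.real_cond_exp_ge_c[OF xi_integrable xi_ge_barrier, of t] value_ge_cond_exp_xi[OF t]
    by eventually_elim auto
  from AE_interval_in_closed[OF continuous_paths closed_atLeast this] show ?thesis by simp
qed

section \<open>The value process has constant mean along stopping times\<close>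

text \<open>Optional sampling of the lower bound \<open>E[\<xi> | F\<^sub>t] \<le> Y\<^sub>t\<close>, applied to \<open>- Y\<close>.\<close>

lemma stopped_expectation_ge:
  assumes \<tau>: "stopping_time F \<tau>" "AE \<omega> in M. \<tau> \<omega> \<in> {0..T}"
  shows "m \<le> expectation (\<lambda>\<omega>. Y (\<tau> \<omega>) \<omega>)"
proof -
  interpret neg: continuous_adapted_process M T F "\<lambda>t \<omega>. - Y t \<omega>" S
  proof unfold_locales
    show "AE \<omega> in M. continuous_on {0..T} (\<lambda>t. - Y t \<omega>)"
      using continuous_paths by eventually_elim (rule continuous_on_minus)
  qed (use adapted integrable_S dominated in auto)
  have "(\<integral>\<omega>\<in>space M. - Y (\<tau> \<omega>) \<omega> \<partial>M) \<le> (\<integral>\<omega>\<in>space M. - \<xi> \<omega> \<partial>M)"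
  proof (rule neg.sampling_le)
    fix t A assume t: "t \<in> {0..T}" and A: "A \<in> sets (F t)"
    have "(\<integral>\<omega>\<in>A. \<xi> \<omega> \<partial>M) = (\<integral>\<omega>\<in>A. real_cond_exp M (F t) \<xi> \<omega> \<partial>M)"
      by (rule ce.real_cond_exp_intA[OF xi_integrable A])
    also have "\<dots> \<le> (\<integral>\<omega>\<in>A. Y t \<omega> \<partial>M)"
      unfolding set_lebesgue_integral_def
    proof (rule integral_mono_AE)
      show "AE \<omega> in M. indicat_real A \<omega> *\<^sub>R real_cond_exp M (F t) \<xi> \<omega> \<le> indicat_real A \<omega> *\<^sub>R Y t \<omega>"
        using value_ge_cond_exp_xi[OF t] by eventually_elim (auto simp: indicator_def)
    qed (intro integrable_mult_indicator sets_F_M[OF A] ce.real_cond_exp_int xi_integrable integrable_Y t)+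
    finally show "(\<integral>\<omega>\<in>A. - Y t \<omega> \<partial>M) \<le> (\<integral>\<omega>\<in>A. - \<xi> \<omega> \<partial>M)"
      by (simp add: set_lebesgue_integral_def)
  qed (use xi_integrable \<tau> stopping_time_sets in auto)
  then show ?thesis by (simp add: set_integral_space xi_integrable stopped_integrable[OF \<tau>])
qed

text \<open>The integrated form of \<open>Y\<^sub>t \<le> E[\<xi> + R | F\<^sub>t]\<close> for all \<open>t\<close>.\<close>

definition excess_bound :: "('a \<Rightarrow> real) \<Rightarrow> bool" where
  "excess_bound R \<longleftrightarrow> integrable M R \<and> (\<forall>\<omega>. 0 \<le> R \<omega>) \<and>
    (\<forall>t\<in>{0..T}. \<forall>A\<in>sets (F t). (\<integral>\<omega>\<in>A. Y t \<omega> \<partial>M) \<le> (\<integral>\<omega>\<in>A. \<xi> \<omega> + R \<omega> \<partial>M))"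

lemma excess_boundD:
  assumes "excess_bound R"
  shows "integrable M R" "0 \<le> R \<omega>"
    "t \<in> {0..T} \<Longrightarrow> A \<in> sets (F t) \<Longrightarrow> (\<integral>\<omega>\<in>A. Y t \<omega> \<partial>M) \<le> (\<integral>\<omega>\<in>A. \<xi> \<omega> + R \<omega> \<partial>M)"
  using assms by (auto simp: excess_bound_def)

lemma excess_bound_sampling:
  assumes R: "excess_bound R" and \<tau>: "AE \<omega> in M. \<tau> \<omega> \<in> {0..T}"
    and B: "\<And>s. {\<omega>\<in>B. \<tau> \<omega> \<le> s} \<in> sets (F s)" "B \<in> sets M"
  shows "(\<integral>\<omega>\<in>B. Y (\<tau> \<omega>) \<omega> \<partial>M) \<le> (\<integral>\<omega>\<in>B. \<xi> \<omega> + R \<omega> \<partial>M)"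
  by (rule sampling_le[OF _ _ \<tau> B]) (use excess_boundD[OF R] xi_integrable in auto)

lemma excess_bound_expectation:
  assumes R: "excess_bound R" and \<tau>: "stopping_time F \<tau>" "AE \<omega> in M. \<tau> \<omega> \<in> {0..T}"
  shows "expectation (\<lambda>\<omega>. Y (\<tau> \<omega>) \<omega>) \<le> m + expectation R"
proof -
  have "(\<integral>\<omega>\<in>space M. Y (\<tau> \<omega>) \<omega> \<partial>M) \<le> (\<integral>\<omega>\<in>space M. \<xi> \<omega> + R \<omega> \<partial>M)"
    by (rule excess_bound_sampling[OF R \<tau>(2)]) (use stopping_time_sets[OF \<tau>(1)] in auto)
  then show ?thesis
    using excess_boundD(1)[OF R] xi_integrable stopped_integrable[OF \<tau>] by (simp add: set_integral_space)
qed

text \<open>The contraction estimate. On \<open>{\<tau> < T}\<close> the payoff is affinely dominated by \<open>Y\<^sub>\<tau>\<close>, to which sampling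
  applies because \<open>A \<inter> {\<tau> < T}\<close> is an event prior to \<open>\<tau>\<close>; the barrier term is then absorbed by
  \<open>barrier \<le> \<xi>\<close>. The mean-field term costs at most \<open>\<gamma>\<^sub>2 E[R]\<close>, since \<open>E[Y\<^sub>\<tau>]\<close> lies between \<open>m\<close> and
  \<open>m + E[R]\<close>.\<close>

lemma set_integral_payoff_le:
  assumes R: "excess_bound R" and t: "t \<in> {0..T}" and \<tau>: "\<tau> \<in> stopping_from t" and A: "A \<in> sets (F t)"
  shows "(\<integral>\<omega>\<in>A. payoff \<tau> \<omega> \<partial>M) \<le> (\<integral>\<omega>\<in>A. \<xi> \<omega> + (\<gamma>\<^sub>1 * R \<omega> + \<gamma>\<^sub>2 * expectation R) \<partial>M)"
proof -
  have \<tau>s: "stopping_time F \<tau>" "AE \<omega> in M. \<tau> \<omega> \<in> {0..T}" "AE \<omega> in M. \<tau> \<omega> \<in> {t..T}"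
    using stopping_fromD[OF \<tau>] t by auto
  have [measurable]: "\<tau> \<in> borel_measurable M" by (rule stopping_time_measurable[OF \<tau>s(1)])
  have AM[measurable]: "A \<in> sets M" by (rule sets_F_M[OF A])
  note R' = excess_boundD(1,2)[OF R]
  have Asub: "A \<subseteq> space M" using AM by (rule sets.sets_into_space)
  define B where "B = {\<omega>\<in>A. \<tau> \<omega> < T}"
  define C where "C = {\<omega>\<in>A. \<tau> \<omega> = T}"
  have "B = A \<inter> {\<omega>\<in>space M. \<tau> \<omega> < T}" "C = A \<inter> {\<omega>\<in>space M. \<tau> \<omega> = T}"
    using Asub by (auto simp: B_def C_def)
  then have BC: "B \<in> sets M" "C \<in> sets M" by (auto intro!: sets.Int)
  have BF: "{\<omega>\<in>B. \<tau> \<omega> \<le> s} \<in> sets (F s)" for s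
  proof -
    consider "s < t" | "t \<le> s" "s < T" | "t \<le> s" "T \<le> s" by linarith
    then show ?thesis
    \<comment> \<open>Before \<open>t\<close> the event is null, but only null: \<open>\<tau> \<ge> t\<close> holds almost surely.\<close>
    proof cases
      case 1
      have "AE \<omega> in M. \<omega> \<in> {} \<longleftrightarrow> \<omega> \<in> {\<omega>\<in>B. \<tau> \<omega> \<le> s}"
        using \<tau>s(3) by eventually_elim (use 1 in auto)
      then show ?thesis by (rule sets_F_AE_eq[rotated]) (use Asub in \<open>auto simp: B_def\<close>)
    next
      case 2
      have "{\<omega>\<in>B. \<tau> \<omega> \<le> s} = A \<inter> {\<omega> \<in> space M. \<tau> \<omega> \<le> s}"
        using 2 Asub by (auto simp: B_def)
      then show ?thesis
        using F_mono[OF 2(1)] A stopping_time_sets[OF \<tau>s(1), of s] by auto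
    next
      case 3
      have "filtration (space M) F"
        by unfold_locales (use space_F F_mono in auto)
      then have "Measurable.pred (F s) (\<lambda>\<omega>. \<tau> \<omega> < T)"
        using filtration.stopping_time_less_const[of "space M" F \<tau> T] \<tau>s(1) 3
        by (auto simp: pred_def space_F dest!: F_mono[THEN subsetD, OF 3(2)])
      then have "{\<omega>\<in>space M. \<tau> \<omega> < T} \<in> sets (F s)" by (simp add: pred_def space_F)
      then have "A \<inter> {\<omega>\<in>space M. \<tau> \<omega> < T} \<in> sets (F s)" using F_mono[OF 3(1)] A by auto
      also have "A \<inter> {\<omega>\<in>space M. \<tau> \<omega> < T} = {\<omega>\<in>B. \<tau> \<omega> \<le> s}"
        using 3 Asub by (auto simp: B_def)
      finally show ?thesis .
    qed
  qed
  define Z where "Z \<omega> = Y (\<tau> \<omega>) \<omega>" for \<omega>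
  define e where "e = expectation R"
  define k where "k = (1 - \<gamma>\<^sub>1) * barrier + \<gamma>\<^sub>2 * e"
  have e0: "0 \<le> e" unfolding e_def using R' by (intro integral_nonneg_AE) auto
  have Z: "integrable M Z" unfolding Z_def by (rule stopped_integrable[OF \<tau>s(1,2)])
  have Zm: "\<bar>expectation Z - m\<bar> \<le> e"
    using stopped_expectation_ge[OF \<tau>s(1,2)] excess_bound_expectation[OF R \<tau>s(1,2)]
    by (simp add: Z_def[abs_def] e_def)
  have ZB: "(\<integral>\<omega>. indicator B \<omega> *\<^sub>R Z \<omega> \<partial>M) \<le> (\<integral>\<omega>. indicator B \<omega> *\<^sub>R (\<xi> \<omega> + R \<omega>) \<partial>M)"
    using excess_bound_sampling[OF R \<tau>s(2) BF BC(1)] by (simp add: set_lebesgue_integral_def Z_def)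
  \<comment> \<open>\<open>U\<close> collects the part of the payoff bound that does not contain \<open>Y\<close>.\<close>
  define U where "U \<omega> = indicator B \<omega> *\<^sub>R k + indicator C \<omega> *\<^sub>R \<xi> \<omega>" for \<omega>
  have U: "integrable M U" unfolding U_def
    by (intro Bochner_Integration.integrable_add integrable_mult_indicator BC xi_integrable) simp
  have iZ: "integrable M (\<lambda>\<omega>. indicator B \<omega> *\<^sub>R Z \<omega>)"
    and iX: "integrable M (\<lambda>\<omega>. indicator B \<omega> *\<^sub>R (\<xi> \<omega> + R \<omega>))"
    by (intro integrable_mult_indicator Bochner_Integration.integrable_add BC Z xi_integrable R')+
  have "(\<integral>\<omega>\<in>A. payoff \<tau> \<omega> \<partial>M) \<le> (\<integral>\<omega>. U \<omega> + \<gamma>\<^sub>1 * (indicator B \<omega> *\<^sub>R Z \<omega>) \<partial>M)"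
    unfolding set_lebesgue_integral_def
  proof (rule integral_mono_AE)
    show "AE \<omega> in M. indicat_real A \<omega> *\<^sub>R payoff \<tau> \<omega> \<le> U \<omega> + \<gamma>\<^sub>1 * (indicat_real B \<omega> *\<^sub>R Z \<omega>)"
      using \<tau>s(2) value_ge_barrier
    proof eventually_elim
      case (elim \<omega>)
      have "barrier \<le> Z \<omega>" using elim by (auto simp: Z_def)
      from h_le_above_barrier[OF this, of "expectation Z"]
      have "h (Z \<omega>) (expectation Z) \<le> (1 - \<gamma>\<^sub>1) * barrier + \<gamma>\<^sub>1 * Z \<omega> + \<gamma>\<^sub>2 * \<bar>expectation Z - m\<bar>" .
      also have "\<dots> \<le> (1 - \<gamma>\<^sub>1) * barrier + \<gamma>\<^sub>1 * Z \<omega> + \<gamma>\<^sub>2 * e"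
        using Zm gamma_nonneg by (intro add_left_mono mult_left_mono) auto
      finally have "h (Z \<omega>) (expectation Z) \<le> k + \<gamma>\<^sub>1 * Z \<omega>" by (simp add: k_def)
      then show ?case using elim(1)
        by (auto simp: mf_payoff_def U_def Z_def[symmetric] B_def C_def indicator_def)
    qed
  qed (intro integrable_mult_indicator Bochner_Integration.integrable_add integrable_mult_right AM U iZ
      payoff_integrable \<tau>s)+
  also have "\<dots> = (\<integral>\<omega>. U \<omega> \<partial>M) + \<gamma>\<^sub>1 * (\<integral>\<omega>. indicator B \<omega> *\<^sub>R Z \<omega> \<partial>M)"
    using U iZ by simp
  also have "\<dots> \<le> (\<integral>\<omega>. U \<omega> \<partial>M) + \<gamma>\<^sub>1 * (\<integral>\<omega>. indicator B \<omega> *\<^sub>R (\<xi> \<omega> + R \<omega>) \<partial>M)"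
    using ZB gamma_nonneg by (intro add_left_mono mult_left_mono)
  also have "\<dots> = (\<integral>\<omega>. U \<omega> + \<gamma>\<^sub>1 * (indicator B \<omega> *\<^sub>R (\<xi> \<omega> + R \<omega>)) \<partial>M)"
    using U iX by simp
  also have "\<dots> \<le> (\<integral>\<omega>\<in>A. \<xi> \<omega> + (\<gamma>\<^sub>1 * R \<omega> + \<gamma>\<^sub>2 * e) \<partial>M)"
    unfolding set_lebesgue_integral_def
  proof (rule integral_mono_AE)
    show "AE \<omega> in M. U \<omega> + \<gamma>\<^sub>1 * (indicat_real B \<omega> *\<^sub>R (\<xi> \<omega> + R \<omega>))
        \<le> indicat_real A \<omega> *\<^sub>R (\<xi> \<omega> + (\<gamma>\<^sub>1 * R \<omega> + \<gamma>\<^sub>2 * e))"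
      using \<tau>s(2) xi_ge_barrier
    proof eventually_elim
      case (elim \<omega>)
      have "(1 - \<gamma>\<^sub>1) * barrier \<le> (1 - \<gamma>\<^sub>1) * \<xi> \<omega>"
        using elim(2) gamma_nonneg gamma_less by (intro mult_left_mono) auto
      then have "k + \<gamma>\<^sub>1 * (\<xi> \<omega> + R \<omega>) \<le> \<xi> \<omega> + (\<gamma>\<^sub>1 * R \<omega> + \<gamma>\<^sub>2 * e)"
        by (simp add: k_def algebra_simps)
      moreover have "0 \<le> \<gamma>\<^sub>1 * R \<omega> + \<gamma>\<^sub>2 * e"
        using gamma_nonneg R' e0 by simp
      ultimately show ?case using elim(1)
        by (auto simp: U_def B_def C_def indicator_def)
    qed
  qed (intro integrable_mult_indicator Bochner_Integration.integrable_add integrable_mult_right AM U iX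
      xi_integrable R' integrable_const)+
  finally show ?thesis by (simp add: e_def)
qed

text \<open>The preceding estimate makes \<open>E[\<xi> + \<gamma>\<^sub>1 R + \<gamma>\<^sub>2 E[R] | F\<^sub>t]\<close> an upper bound of the family of conditional
  payoffs, so it dominates the essential supremum \<open>Y\<^sub>t\<close>. Minimality replaces the usual passage to a
  maximizing sequence: the family is in general not directed upwards, because pasting two stopping
  times changes the mean-field argument of both.\<close>

lemma excess_bound_step:
  assumes R: "excess_bound R"
  shows "excess_bound (\<lambda>\<omega>. \<gamma>\<^sub>1 * R \<omega> + \<gamma>\<^sub>2 * expectation R)"
proof -
  let ?R = "\<lambda>\<omega>. \<gamma>\<^sub>1 * R \<omega> + \<gamma>\<^sub>2 * expectation R"
  note R' = excess_boundD(1,2)[OF R]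
  have i: "integrable M ?R" using R' by simp
  have iX: "integrable M (\<lambda>\<omega>. \<xi> \<omega> + ?R \<omega>)"
    using i xi_integrable by (rule Bochner_Integration.integrable_add[rotated])
  have "0 \<le> expectation R" using R' by (intro integral_nonneg_AE) auto
  then have nn: "0 \<le> ?R \<omega>" for \<omega> using R' gamma_nonneg by simp
  have "(\<integral>\<omega>\<in>A. Y t \<omega> \<partial>M) \<le> (\<integral>\<omega>\<in>A. \<xi> \<omega> + ?R \<omega> \<partial>M)" if t: "t \<in> {0..T}" and A: "A \<in> sets (F t)" for t A
  proof -
    let ?E = "real_cond_exp M (F t) (\<lambda>\<omega>. \<xi> \<omega> + ?R \<omega>)"
    have "AE \<omega> in M. real_cond_exp M (F t) (payoff \<tau>) \<omega> \<le> ?E \<omega>" if \<tau>: "\<tau> \<in> stopping_from t" for \<tau>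
      using stopping_fromD[OF \<tau>] t
      by (intro ce.real_cond_exp_le_of_set_integral_le iX payoff_integrable set_integral_payoff_le[OF R t \<tau>]) auto
    then have le: "AE \<omega> in M. Y t \<omega> \<le> ?E \<omega>"
      using value_ess_sup[OF t] borel_measurable_cond_exp2[of M "F t"] unfolding is_ess_sup_def by blast
    have "(\<integral>\<omega>\<in>A. Y t \<omega> \<partial>M) \<le> (\<integral>\<omega>\<in>A. ?E \<omega> \<partial>M)"
      unfolding set_lebesgue_integral_def
    proof (rule integral_mono_AE)
      show "AE \<omega> in M. indicat_real A \<omega> *\<^sub>R Y t \<omega> \<le> indicat_real A \<omega> *\<^sub>R ?E \<omega>"
        using le by eventually_elim (auto simp: indicator_def)
    qed (intro integrable_mult_indicator sets_F_M[OF A] integrable_Y t ce.real_cond_exp_int iX)+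
    also have "\<dots> = (\<integral>\<omega>\<in>A. \<xi> \<omega> + ?R \<omega> \<partial>M)"
      by (rule ce.real_cond_exp_intA[OF iX A, symmetric])
    finally show ?thesis .
  qed
  then show ?thesis using i nn by (simp add: excess_bound_def)
qed

lemma excess_bound_initial: "excess_bound (\<lambda>\<omega>. \<bar>S \<omega>\<bar> + \<bar>\<xi> \<omega>\<bar>)"
  unfolding excess_bound_def
proof (intro conjI ballI allI)
  show i: "integrable M (\<lambda>\<omega>. \<bar>S \<omega>\<bar> + \<bar>\<xi> \<omega>\<bar>)" using integrable_S xi_integrable by simp
  fix t A assume t: "t \<in> {0..T}" and A: "A \<in> sets (F t)"
  show "(\<integral>\<omega>\<in>A. Y t \<omega> \<partial>M) \<le> (\<integral>\<omega>\<in>A. \<xi> \<omega> + (\<bar>S \<omega>\<bar> + \<bar>\<xi> \<omega>\<bar>) \<partial>M)"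
    unfolding set_lebesgue_integral_def
  proof (rule integral_mono_AE)
    show "AE \<omega> in M. indicat_real A \<omega> *\<^sub>R Y t \<omega> \<le> indicat_real A \<omega> *\<^sub>R (\<xi> \<omega> + (\<bar>S \<omega>\<bar> + \<bar>\<xi> \<omega>\<bar>))"
      using dominated by eventually_elim (use t in \<open>fastforce simp: indicator_def\<close>)
  qed (intro integrable_mult_indicator Bochner_Integration.integrable_add sets_F_M[OF A] integrable_Y t i xi_integrable)+
qed simp

text \<open>Iterating the step multiplies the mean of the bound by \<open>\<gamma>\<^sub>1 + \<gamma>\<^sub>2\<close> each time.\<close>

theorem stopped_expectation_eq:
  assumes \<tau>: "stopping_time F \<tau>" "AE \<omega> in M. \<tau> \<omega> \<in> {0..T}"
  shows "expectation (\<lambda>\<omega>. Y (\<tau> \<omega>) \<omega>) = m"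
proof (rule antisym)
  define c where "c = expectation (\<lambda>\<omega>. \<bar>S \<omega>\<bar> + \<bar>\<xi> \<omega>\<bar>)"
  have "\<exists>R. excess_bound R \<and> expectation R = (\<gamma>\<^sub>1 + \<gamma>\<^sub>2) ^ n * c" for n
  proof (induction n)
    case 0
    then show ?case using excess_bound_initial by (auto simp: c_def)
  next
    case (Suc n)
    then obtain R where R: "excess_bound R" "expectation R = (\<gamma>\<^sub>1 + \<gamma>\<^sub>2) ^ n * c" by blast
    have "expectation (\<lambda>\<omega>. \<gamma>\<^sub>1 * R \<omega> + \<gamma>\<^sub>2 * expectation R) = (\<gamma>\<^sub>1 + \<gamma>\<^sub>2) * expectation R"
      using excess_boundD(1)[OF R(1)] by (simp add: prob_space algebra_simps)
    then show ?case using excess_bound_step[OF R(1)] R(2) by (auto simp: mult.assoc)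
  qed
  then have "expectation (\<lambda>\<omega>. Y (\<tau> \<omega>) \<omega>) \<le> m + (\<gamma>\<^sub>1 + \<gamma>\<^sub>2) ^ n * c" for n
    using excess_bound_expectation[OF _ \<tau>] by metis
  moreover have "(\<lambda>n. m + (\<gamma>\<^sub>1 + \<gamma>\<^sub>2) ^ n * c) \<longlonglongrightarrow> m + 0 * c"
    using gamma_nonneg gamma_less by (intro tendsto_intros LIMSEQ_power_zero) auto
  ultimately show "expectation (\<lambda>\<omega>. Y (\<tau> \<omega>) \<omega>) \<le> m"
    using LIMSEQ_le_const[of "\<lambda>n. m + (\<gamma>\<^sub>1 + \<gamma>\<^sub>2) ^ n * c"] by auto
qed (rule stopped_expectation_ge[OF \<tau>])

section \<open>Optimality of the hitting time\<close>

lemma payoff_expectation_le: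
  assumes \<tau>: "stopping_time F \<tau>" "AE \<omega> in M. \<tau> \<omega> \<in> {0..T}"
  shows "expectation (payoff \<tau>) \<le> m"
proof -
  have "expectation (payoff \<tau>) \<le> expectation (\<lambda>\<omega>. Y (\<tau> \<omega>) \<omega>)"
  proof (rule integral_mono_AE[OF payoff_integrable[OF \<tau>] stopped_integrable[OF \<tau>]])
    show "AE \<omega> in M. payoff \<tau> \<omega> \<le> Y (\<tau> \<omega>) \<omega>"
      using \<tau>(2) value_ge_barrier value_terminal
    proof eventually_elim
      case (elim \<omega>)
      have b: "barrier \<le> Y (\<tau> \<omega>) \<omega>" using elim by blast
      moreover have "(1 - \<gamma>\<^sub>1) * barrier \<le> (1 - \<gamma>\<^sub>1) * Y (\<tau> \<omega>) \<omega>"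
        using b gamma_nonneg gamma_less by (intro mult_left_mono) auto
      ultimately have "h (Y (\<tau> \<omega>) \<omega>) m \<le> Y (\<tau> \<omega>) \<omega>"
        using h_le_above_barrier[OF b, of m] by (simp add: algebra_simps)
      then show ?case using elim by (auto simp: mf_payoff_def stopped_expectation_eq[OF \<tau>] indicator_def)
    qed
  qed
  then show ?thesis by (simp add: stopped_expectation_eq[OF \<tau>])
qed

lemma value_expectation: "t \<in> {0..T} \<Longrightarrow> expectation (Y t) = m"
  using stopped_expectation_eq[of "\<lambda>_. t"] by (simp add: stopping_time_const)

text \<open>Since \<open>E[Y\<^sub>t] = m\<close> for all \<open>t\<close>, the moving target of the hitting time is the fixed point of
  \<open>h(\<cdot>, m)\<close>.\<close>

lemma hitting_time_eq:
  "mf_hitting_time M T h Y \<omega> = Inf (insert T {t\<in>{0..T}. Y t \<omega> = barrier})"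
proof -
  have "{t\<in>{0..T}. Y t \<omega> = h (Y t \<omega>) (expectation (Y t))} = {t\<in>{0..T}. Y t \<omega> = barrier}"
    using value_expectation h_eq_iff_barrier by auto
  then show ?thesis by (simp add: mf_hitting_time_def)
qed

lemma hitting_time_range: "mf_hitting_time M T h Y \<omega> \<in> {0..T}"
  unfolding hitting_time_eq using T_pos
  by (auto intro!: cInf_greatest cInf_lower bdd_belowI[of _ 0])

lemma hitting_time_attained:
  assumes "continuous_on {0..T} (\<lambda>t. Y t \<omega>)"
  shows "mf_hitting_time M T h Y \<omega> \<in> insert T {t\<in>{0..T}. Y t \<omega> = barrier}"
proof -
  have "closed ({0..T} \<inter> (\<lambda>t. Y t \<omega>) -` {barrier})"
    by (rule continuous_closed_preimage[OF assms closed_atLeastAtMost closed_singleton])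
  also have "{0..T} \<inter> (\<lambda>t. Y t \<omega>) -` {barrier} = {t\<in>{0..T}. Y t \<omega> = barrier}" by auto
  finally have "closed (insert T {t\<in>{0..T}. Y t \<omega> = barrier})" by (simp add: closed_insert)
  then show ?thesis unfolding hitting_time_eq
    by (rule closed_contains_Inf[rotated 2]) (use T_pos in \<open>auto intro!: bdd_belowI[of _ 0]\<close>)
qed

lemma hitting_time_le_iff:
  assumes cont: "continuous_on {0..T} (\<lambda>t. Y t \<omega>)" and s: "s < T"
  shows "mf_hitting_time M T h Y \<omega> \<le> s \<longleftrightarrow> (\<exists>t\<in>{0..s}. Y t \<omega> = barrier)"
proof
  assume "mf_hitting_time M T h Y \<omega> \<le> s"
  then show "\<exists>t\<in>{0..s}. Y t \<omega> = barrier"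
    using hitting_time_attained[OF cont] s by auto
next
  assume "\<exists>t\<in>{0..s}. Y t \<omega> = barrier"
  then obtain t where "t \<in> {0..s}" "Y t \<omega> = barrier" by blast
  then have "mf_hitting_time M T h Y \<omega> \<le> t"
    unfolding hitting_time_eq using s T_pos by (intro cInf_lower) (auto intro!: bdd_belowI[of _ 0])
  then show "mf_hitting_time M T h Y \<omega> \<le> s" using \<open>t \<in> {0..s}\<close> by simp
qed

text \<open>The event \<open>{\<tau> \<le> s}\<close> is read off from the path on \<open>[0,s]\<close>, without looking past \<open>s\<close>.
  As \<open>Y\<close> stays above the barrier, it has touched the barrier by time \<open>s\<close> iff its
  infimum over a countable dense set of times in \<open>[0,s]\<close> equals the barrier.\<close>

lemma hitting_time_stopping: "stopping_time F (mf_hitting_time M T h Y)"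
proof
  fix s
  let ?\<tau> = "mf_hitting_time M T h Y"
  consider "s < 0" | "T \<le> s" | "0 \<le> s" "s < T" by linarith
  then have "{\<omega>\<in>space M. ?\<tau> \<omega> \<le> s} \<in> sets (F s)"
  proof cases
    case 1
    then have "\<not> ?\<tau> \<omega> \<le> s" for \<omega> using hitting_time_range[of \<omega>] by simp
    then show ?thesis by simp
  next
    case 2
    then have "?\<tau> \<omega> \<le> s" for \<omega> using hitting_time_range[of \<omega>] by simp
    then have "{\<omega>\<in>space M. ?\<tau> \<omega> \<le> s} = space (F s)" by (simp add: space_F)
    then show ?thesis by simp
  next
    case 3
    obtain D :: "real set" where D: "countable D" "D \<subseteq> {0..s}" "{0..s} \<subseteq> closure D"
      using separable by blast
    have cl: "closure D = {0..s}" using D closure_minimal[OF D(2)] by auto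
    let ?A = "{\<omega>\<in>space (F s). \<forall>n. \<exists>t\<in>D. Y t \<omega> < barrier + inverse (real (Suc n))}"
    have Ym: "Y t \<in> borel_measurable (F s)" if "t \<in> D" for t
    proof -
      have t: "t \<in> {0..T}" "t \<le> s" using that D 3 by auto
      have "subalgebra (F s) (F t)" using F_mono[OF t(2)] by (simp add: subalgebra_def space_F)
      then show ?thesis by (rule measurable_from_subalg[OF _ adapted[OF t(1)]])
    qed
    show ?thesis
    proof (rule sets_F_AE_eq)
      have "{\<omega>\<in>space (F s). Y t \<omega> < c} \<in> sets (F s)" if "t \<in> D" for t c
        using Ym[OF that] by measurable
      then show "?A \<in> sets (F s)"
        by (intro sets.sets_Collect_countable_All sets.sets_Collect_countable_Ex' D(1))
      show "AE \<omega> in M. \<omega> \<in> ?A \<longleftrightarrow> \<omega> \<in> {\<omega>\<in>space M. ?\<tau> \<omega> \<le> s}"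
        using continuous_paths value_ge_barrier
      proof eventually_elim
        case (elim \<omega>)
        have cont: "continuous_on {0..s} (\<lambda>t. Y t \<omega>)"
          using elim(1) by (rule continuous_on_subset) (use 3 in auto)
        have "(\<forall>n. \<exists>t\<in>D. Y t \<omega> < barrier + inverse (real (Suc n))) \<longleftrightarrow> (\<exists>t\<in>{0..s}. Y t \<omega> = barrier)"
        proof
          assume near: "\<forall>n. \<exists>t\<in>D. Y t \<omega> < barrier + inverse (real (Suc n))"
          obtain t where t: "t \<in> {0..s}" "\<forall>u\<in>{0..s}. Y t \<omega> \<le> Y u \<omega>"
            using continuous_attains_inf[OF compact_Icc _ cont] 3 by auto
          have "Y t \<omega> \<le> barrier"
          proof (rule ccontr)
            assume "\<not> Y t \<omega> \<le> barrier"
            then obtain n where "inverse (real (Suc n)) < Y t \<omega> - barrier"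
              using reals_Archimedean[of "Y t \<omega> - barrier"] by auto
            then show False using near[rule_format, of n] t D(2) by fastforce
          qed
          moreover have "barrier \<le> Y t \<omega>" using elim(2) t 3 by auto
          ultimately show "\<exists>t\<in>{0..s}. Y t \<omega> = barrier" using t by force
        next
          assume "\<exists>t\<in>{0..s}. Y t \<omega> = barrier"
          then obtain t where t: "t \<in> {0..s}" "Y t \<omega> = barrier" by blast
          show "\<forall>n. \<exists>t\<in>D. Y t \<omega> < barrier + inverse (real (Suc n))"
          proof (rule ccontr)
            assume "\<not> (\<forall>n. \<exists>t\<in>D. Y t \<omega> < barrier + inverse (real (Suc n)))"
            then obtain n where "\<forall>t\<in>D. barrier + inverse (real (Suc n)) \<le> Y t \<omega>"
              by (auto simp: not_less simp del: of_nat_Suc)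
            then have "(\<lambda>t. Y t \<omega>) ` closure D \<subseteq> {barrier + inverse (real (Suc n))..}"
              by (intro image_closure_subset) (use cont cl in auto)
            with t cl have "barrier + inverse (real (Suc n)) \<le> barrier" by force
            then show False by simp
          qed
        qed
        then show ?case using hitting_time_le_iff[OF elim(1) 3(2)] by (simp add: space_F)
      qed
    qed simp
  qed
  then show "Measurable.pred (F s) (\<lambda>\<omega>. ?\<tau> \<omega> \<le> s)" by (simp add: pred_def space_F)
qed

text \<open>At the hitting time the payoff is \<open>Y\<close> itself, both at the barrier and at \<open>T\<close>, so it attains the
  bound \<open>m\<close>.\<close>

theorem hitting_time_optimal:
  "is_arg_max (\<lambda>\<tau>. expectation (payoff \<tau>)) (\<lambda>\<tau>. \<tau> \<in> stopping_from 0) (mf_hitting_time M T h Y)"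
proof -
  let ?\<tau> = "mf_hitting_time M T h Y"
  have \<tau>: "stopping_time F ?\<tau>" "AE \<omega> in M. ?\<tau> \<omega> \<in> {0..T}"
    using hitting_time_stopping hitting_time_range by auto
  have "AE \<omega> in M. payoff ?\<tau> \<omega> = Y (?\<tau> \<omega>) \<omega>"
    using continuous_paths value_terminal
  proof eventually_elim
    case (elim \<omega>)
    show ?case
      using hitting_time_attained[OF elim(1)] hitting_time_range[of \<omega>] elim(2) h_barrier
      by (cases "?\<tau> \<omega> = T") (auto simp: mf_payoff_def stopped_expectation_eq[OF \<tau>] indicator_def)
  qed
  then have "expectation (payoff ?\<tau>) = m"
    using integral_cong_AE[OF borel_measurable_integrable[OF payoff_integrable[OF \<tau>]]
      stopped_measurable[OF \<tau>]] stopped_expectation_eq[OF \<tau>] by simp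
  moreover have "expectation (payoff \<sigma>) \<le> m" if "\<sigma> \<in> stopping_from 0" for \<sigma>
    using stopping_fromD[OF that] by (intro payoff_expectation_le) auto
  moreover have "?\<tau> \<in> stopping_from 0"
    using \<tau> by (simp add: stopping_times_from_def)
  ultimately show ?thesis by (force simp: is_arg_max_def)
qed

end

section \<open>The Brownian setting\<close>

lemma completed_filtration_complete:
  assumes "prob_space M" "complete_measure M" "0 < T"
    and W: "standard_brownian_motion M T W"
  shows "complete_filtration M T (completed_filtration M T W)"
proof -
  define G where "G t = {W s -` B \<inter> space M | s B. s \<in> {0..T} \<and> s \<le> t \<and> B \<in> sets borel} \<union> null_sets M" for t
  have GM: "G t \<subseteq> sets M" for t
    using W unfolding G_def standard_brownian_motion_def by (auto intro!: measurable_sets)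
  then have "G t \<subseteq> Pow (space M)" for t using sets.sets_into_space by blast
  then have sets: "sets (completed_filtration M T W t) = sigma_sets (space M) (G t)"
    and space: "space (completed_filtration M T W t) = space M" for t
    by (simp_all add: completed_filtration_def G_def)
  show ?thesis
  proof (intro complete_filtration.intro complete_filtration_axioms.intro assms)
    fix s t :: real
    show "subalgebra M (completed_filtration M T W t)"
      unfolding subalgebra_def sets space using sets.sigma_sets_subset[OF GM] by simp
    show "sets (completed_filtration M T W s) \<subseteq> sets (completed_filtration M T W t)" if "s \<le> t"
    proof -
      have "G s \<subseteq> G t" unfolding G_def using order_trans[OF _ that] by blast
      then show ?thesis unfolding sets by (rule sigma_sets_mono')
    qed
    show "null_sets M \<subseteq> sets (completed_filtration M T W t)"
      unfolding sets by (auto simp: G_def intro: sigma_sets.Basic)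
  qed
qed

lemma progressively_measurable_adapted:
  assumes Y: "progressively_measurable T F Y" and t: "t \<in> {0..T}"
  shows "Y t \<in> borel_measurable (F t)"
proof -
  have "(\<lambda>\<omega>. (t, \<omega>)) \<in> measurable (F t) (restrict_space borel {0..t} \<Otimes>\<^sub>M F t)"
    using t by (intro measurable_Pair measurable_const measurable_ident) (auto simp: space_restrict_space)
  moreover have "(\<lambda>(s, \<omega>). Y s \<omega>) \<in> borel_measurable (restrict_space borel {0..t} \<Otimes>\<^sub>M F t)"
    using Y t by (simp add: progressively_measurable_def)
  ultimately have "(\<lambda>\<omega>. case (t, \<omega>) of (s, \<omega>) \<Rightarrow> Y s \<omega>) \<in> borel_measurable (F t)"
    by (rule measurable_compose)
  then show ?thesis by simp
qed

text \<open>The supremum over all times in the definition of the space need not be measurable, so it is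
  replaced by one over a countable dense set of times. The bound \<open>1 + sup Y\<^sup>2\<close> avoids a square root.\<close>

lemma S2c_dominated:
  assumes M: "prob_space M" and Y: "Y \<in> S2c M T F" and meas: "\<And>t. t \<in> {0..T} \<Longrightarrow> Y t \<in> borel_measurable M"
  obtains S where "integrable M S" "AE \<omega> in M. \<forall>t\<in>{0..T}. \<bar>Y t \<omega>\<bar> \<le> S \<omega>"
proof -
  interpret prob_space M by fact
  obtain D :: "real set" where D: "countable D" "D \<subseteq> {0..T}" "{0..T} \<subseteq> closure D"
    using separable by blast
  have cl: "closure D = {0..T}" using D closure_minimal[OF D(2)] by auto
  define f where "f \<omega> = (SUP u\<in>D. ennreal (\<bar>Y u \<omega>\<bar>\<^sup>2))" for \<omega>
  have f[measurable]: "f \<in> borel_measurable M"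
    unfolding f_def using D meas by (intro borel_measurable_SUP) auto
  have "(\<integral>\<^sup>+\<omega>. f \<omega> \<partial>M) \<le> (\<integral>\<^sup>+ \<omega>. (SUP u\<in>{0..T}. ennreal (\<bar>Y u \<omega>\<bar>\<^sup>2)) \<partial>M)"
    unfolding f_def using D(2) by (intro nn_integral_mono SUP_subset_mono) auto
  also have "\<dots> < \<infinity>" using Y by (simp add: S2c_def)
  finally have fin: "(\<integral>\<^sup>+\<omega>. f \<omega> \<partial>M) < \<infinity>" .
  then have f_fin: "AE \<omega> in M. f \<omega> \<noteq> \<infinity>"
    by (intro nn_integral_PInf_AE) auto
  have "(\<integral>\<^sup>+\<omega>. ennreal (norm (enn2real (f \<omega>))) \<partial>M) = (\<integral>\<^sup>+\<omega>. f \<omega> \<partial>M)"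
    by (rule nn_integral_cong_AE, use f_fin in eventually_elim) (simp add: less_top)
  with fin have "integrable M (\<lambda>\<omega>. enn2real (f \<omega>))"
    by (intro integrableI_bounded) auto
  then have "integrable M (\<lambda>\<omega>. 1 + enn2real (f \<omega>))" by simp
  moreover have "AE \<omega> in M. continuous_on {0..T} (\<lambda>t. Y t \<omega>)" using Y by (simp add: S2c_def)
  with f_fin have "AE \<omega> in M. \<forall>t\<in>{0..T}. \<bar>Y t \<omega>\<bar> \<le> 1 + enn2real (f \<omega>)"
  proof eventually_elim
    case (elim \<omega>)
    define c where "c = 1 + enn2real (f \<omega>)"
    have "\<bar>Y u \<omega>\<bar> \<le> c" if "u \<in> D" for u
    proof -
      have "ennreal (\<bar>Y u \<omega>\<bar>\<^sup>2) \<le> f \<omega>" unfolding f_def by (rule SUP_upper[OF that])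
      then have "\<bar>Y u \<omega>\<bar>\<^sup>2 \<le> enn2real (f \<omega>)"
        using elim(1) enn2real_mono[of "ennreal (\<bar>Y u \<omega>\<bar>\<^sup>2)" "f \<omega>"] by (simp add: less_top)
      moreover have "0 \<le> (\<bar>Y u \<omega>\<bar> - 1)\<^sup>2 + \<bar>Y u \<omega>\<bar>\<^sup>2 + 1" by simp
      ultimately show ?thesis by (simp add: c_def power2_eq_square algebra_simps)
    qed
    then have "(\<lambda>t. Y t \<omega>) ` closure D \<subseteq> {- c..c}"
      by (intro image_closure_subset) (use elim cl in \<open>auto simp: abs_le_iff\<close>, force)
    then show ?case using cl by (auto simp: c_def[symmetric] abs_le_iff)
  qed
  ultimately show ?thesis by (rule that)
qed

theorem theorem3p4:
  fixes M :: "'a measure" and T :: real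
    and W :: "nat \<Rightarrow> real \<Rightarrow> 'a \<Rightarrow> real"
    and F :: "nat \<Rightarrow> real \<Rightarrow> 'a measure"
    and \<xi> :: "nat \<Rightarrow> 'a \<Rightarrow> real"
    and h :: "real \<Rightarrow> real \<Rightarrow> real"
    and \<gamma>\<^sub>1 \<gamma>\<^sub>2 :: real
    and Y :: "nat \<Rightarrow> real \<Rightarrow> 'a \<Rightarrow> real"
  assumes "prob_space M" and "complete_measure M" and "0 < T"
    and "\<And>i. i \<ge> 1 \<Longrightarrow> standard_brownian_motion M T (W i)"
    and "independent_processes M T W {1..}"
    and "\<And>i t. F i t = completed_filtration M T (W i) t"
    and "\<And>i. i \<ge> 1 \<Longrightarrow> \<xi> i \<in> L2_rv M (F i T)"
    and "prob_space.indep_vars M (\<lambda>_. borel) \<xi> {1..}"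
    and "\<And>i. i \<ge> 1 \<Longrightarrow> distr M borel (\<xi> i) = distr M borel (\<xi> 1)"
    and "0 < \<gamma>\<^sub>1" and "0 < \<gamma>\<^sub>2"
    and "\<And>y\<^sub>1 y\<^sub>2 z\<^sub>1 z\<^sub>2. \<bar>h y\<^sub>1 z\<^sub>1 - h y\<^sub>2 z\<^sub>2\<bar> \<le> \<gamma>\<^sub>1 * \<bar>y\<^sub>1 - y\<^sub>2\<bar> + \<gamma>\<^sub>2 * \<bar>z\<^sub>1 - z\<^sub>2\<bar>"
    and "\<gamma>\<^sub>1\<^sup>2 + \<gamma>\<^sub>2\<^sup>2 < 1 / 16"
    and "\<And>i. i \<ge> 1 \<Longrightarrow> mf_value_process M T (F i) h (\<xi> i) (Y i)"
  shows "\<forall>i\<ge>1. is_arg_max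
           (\<lambda>\<tau>. \<integral>\<omega>. mf_payoff M T h (\<xi> i) (Y i) \<tau> \<omega> \<partial>M)
           (\<lambda>\<tau>. \<tau> \<in> stopping_times_from M T (F i) 0)
           (mf_hitting_time M T h (Y i))"
proof (intro allI impI)
  fix i :: nat assume i: "1 \<le> i"
  have F: "F i = completed_filtration M T (W i)" using assms(6) by auto
  interpret filt: complete_filtration M T "F i"
    unfolding F by (rule completed_filtration_complete) (use assms i in auto)
  have Y: "Y i \<in> S2c M T (F i)" and ess: "\<And>t. t \<in> {0..T} \<Longrightarrow> is_ess_sup M
        ((\<lambda>\<tau>. real_cond_exp M (F i t) (mf_payoff M T h (\<xi> i) (Y i) \<tau>)) ` stopping_times_from M T (F i) t) (Y i t)"
    using assms(14)[OF i] by (auto simp: mf_value_process_def)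
  have adapted: "Y i t \<in> borel_measurable (F i t)" if "t \<in> {0..T}" for t
    using Y that by (intro progressively_measurable_adapted[of T]) (simp add: S2c_def)
  obtain S where S: "integrable M S" "AE \<omega> in M. \<forall>t\<in>{0..T}. \<bar>Y i t \<omega>\<bar> \<le> S \<omega>"
    using S2c_dominated[OF assms(1) Y filt.measurable_F_M[OF adapted]] by blast
  have xi: "\<xi> i \<in> borel_measurable (F i T)" "integrable M (\<lambda>\<omega>. (\<xi> i \<omega>)\<^sup>2)"
    using assms(7)[OF i] by (simp_all add: L2_rv_def)
  then have xi_int: "integrable M (\<xi> i)"
    using filt.square_integrable_imp_integrable[OF filt.measurable_F_M] by blast
  have less: "\<gamma>\<^sub>1 + \<gamma>\<^sub>2 < 1"
  proof -
    have "(\<gamma>\<^sub>1 + \<gamma>\<^sub>2)\<^sup>2 \<le> 2 * (\<gamma>\<^sub>1\<^sup>2 + \<gamma>\<^sub>2\<^sup>2)"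
      using sum_squares_bound[of \<gamma>\<^sub>1 \<gamma>\<^sub>2] by (simp add: power2_sum)
    then have "(\<gamma>\<^sub>1 + \<gamma>\<^sub>2)\<^sup>2 < 1\<^sup>2" using assms(13) by simp
    then show ?thesis by (rule power_less_imp_less_base) simp
  qed
  have cont: "AE \<omega> in M. continuous_on {0..T} (\<lambda>t. Y i t \<omega>)" using Y by (simp add: S2c_def)
  interpret mean_field_value M T "F i" "Y i" S "\<xi> i" h \<gamma>\<^sub>1 \<gamma>\<^sub>2
    by unfold_locales (fact adapted cont S xi xi_int less ess assms(12) assms(10,11)[THEN less_imp_le])+
  show "is_arg_max
           (\<lambda>\<tau>. \<integral>\<omega>. mf_payoff M T h (\<xi> i) (Y i) \<tau> \<omega> \<partial>M)
           (\<lambda>\<tau>. \<tau> \<in> stopping_times_from M T (F i) 0)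
           (mf_hitting_time M T h (Y i))"
    by (rule hitting_time_optimal)
qed

end
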